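(* (1) A set $S\subseteq\mathbb{Z}^n$ is M-convex if and only if it is both M$_2$-convex and M$^\natural$-convex. (2) A function $f:\mathbb{Z}^n\to\mathbb{R}\cup\{+\infty\}$ is M-convex if and only if it is both M$_2$-convex and M$^\natural$-convex.
   Context: $e_i$ is the $i$th unit vector, $e_0=\mathbf{0}$, $\mathrm{supp}^+(z)=\{i:z_i>0\}$, $\mathrm{supp}^-(z)=\{i:z_i<0\}$; functions $f:\mathbb{Z}^n\to\mathbb{R}\cup\{+\infty\}$ have nonempty effective domain $\operatorname{dom} f=\{x:f(x)<+\infty\}$. A function $f$ is M$^\natural$-convex if for all $x,y\in\operatorname{dom} f$ and $i\in\mathrm{supp}^+(x-y)$: $f(x)+f(y)\ge\min_{j\in\mathrm{supp}^-(x-y)\cup\{0\}}\{f(x-e_i+e_j)+f(y+e_i-e_j)\}$. A nonempty set $S$ is M$^\natural$-convex if for $x,y\in S$, $i\in\mathrm{supp}^+(x-y)$: either $x-e_i,y+e_i\in S$, or some $j\in\mathrm{supp}^-(x-y)$ has $x-e_i+e_j,\,y+e_i-e_j\in S$. A nonempty set $S$ is M-convex if for $x,y\in S$, $i\in\mathrm{supp}^+(x-y)$ there is $j\in\mathrm{supp}^-(x-y)$ with $x-e_i+e_j,\,y+e_i-e_j\in S$. A function is M-convex if it is M$^\natural$-convex and its effective domain is an M-convex set. A nonempty set is M$_2$-convex if it is the intersection of two M-convex sets. A function is M$_2$-convex if it is the sum $f_1+f_2$ of two M-convex functions (with nonempty effective domain). *)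

theory Defs
  imports "HOL-Analysis.Finite_Cartesian_Product" "HOL-Library.Extended_Real"
begin

definition supp_pos :: "int ^ 'n \<Rightarrow> 'n set" where
  "supp_pos z = {i. z $ i > 0}"

definition supp_neg :: "int ^ 'n \<Rightarrow> 'n set" where
  "supp_neg z = {i. z $ i < 0}"

text \<open>
  The index set \<open>{1, \<dots>, n} \<union> {0}\<close> is represented by \<open>'n option\<close>:
  \<open>Some i\<close> is a coordinate and \<open>None\<close> is the extra index \<open>0\<close>, for which
  \<open>e\<^sub>0\<close> is the zero vector.
\<close>
fun unit_vec0 :: "'n option \<Rightarrow> int ^ 'n" where
  "unit_vec0 None = 0"
| "unit_vec0 (Some i) = axis i 1"

definition eff_dom :: "(int ^ 'n \<Rightarrow> ereal) \<Rightarrow> (int ^ 'n) set" where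
  "eff_dom f = {x. f x < \<infinity>}"

text \<open>
  The functions under consideration take values in \<open>\<real> \<union> {+\<infinity>}\<close> and have nonempty
  effective domain. As the type \<open>ereal\<close> also contains \<open>-\<infinity>\<close>, that value is excluded here.
\<close>
definition proper_fun :: "(int ^ 'n \<Rightarrow> ereal) \<Rightarrow> bool" where
  "proper_fun f \<longleftrightarrow> (\<forall>x. f x \<noteq> -\<infinity>) \<and> eff_dom f \<noteq> {}"

definition Mnat_convex_set :: "(int ^ 'n) set \<Rightarrow> bool" where
  "Mnat_convex_set S \<longleftrightarrow> S \<noteq> {} \<and>
    (\<forall>x\<in>S. \<forall>y\<in>S. \<forall>i\<in>supp_pos (x - y).
       (x - axis i 1 \<in> S \<and> y + axis i 1 \<in> S) \<or>
       (\<exists>j\<in>supp_neg (x - y). x - axis i 1 + axis j 1 \<in> S \<and> y + axis i 1 - axis j 1 \<in> S))"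

definition M_convex_set :: "(int ^ 'n) set \<Rightarrow> bool" where
  "M_convex_set S \<longleftrightarrow> S \<noteq> {} \<and>
    (\<forall>x\<in>S. \<forall>y\<in>S. \<forall>i\<in>supp_pos (x - y).
       \<exists>j\<in>supp_neg (x - y). x - axis i 1 + axis j 1 \<in> S \<and> y + axis i 1 - axis j 1 \<in> S)"

definition M2_convex_set :: "(int ^ 'n) set \<Rightarrow> bool" where
  "M2_convex_set S \<longleftrightarrow> S \<noteq> {} \<and>
    (\<exists>S1 S2. M_convex_set S1 \<and> M_convex_set S2 \<and> S = S1 \<inter> S2)"

definition Mnat_convex_fun :: "(int ^ 'n \<Rightarrow> ereal) \<Rightarrow> bool" where
  "Mnat_convex_fun f \<longleftrightarrow> proper_fun f \<and>
    (\<forall>x\<in>eff_dom f. \<forall>y\<in>eff_dom f. \<forall>i\<in>supp_pos (x - y).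
       f x + f y \<ge>
         Min ((\<lambda>j. f (x - axis i 1 + unit_vec0 j) + f (y + axis i 1 - unit_vec0 j))
               ` (Some ` supp_neg (x - y) \<union> {None})))"

definition M_convex_fun :: "(int ^ 'n \<Rightarrow> ereal) \<Rightarrow> bool" where
  "M_convex_fun f \<longleftrightarrow> Mnat_convex_fun f \<and> M_convex_set (eff_dom f)"

definition M2_convex_fun :: "(int ^ 'n \<Rightarrow> ereal) \<Rightarrow> bool" where
  "M2_convex_fun f \<longleftrightarrow> eff_dom f \<noteq> {} \<and>
    (\<exists>f1 f2. M_convex_fun f1 \<and> M_convex_fun f2 \<and> f = (\<lambda>x. f1 x + f2 x))"

end

(* Points of an M-convex set all have the same coordinate sum: repeated exchange moves x to y
   without changing the sum of x. An M2-convex set inherits this, and in an Mnat-convex set with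
   constant coordinate sum the alternative x - e_i, y + e_i can never occur, so every exchange is
   an M-exchange. The statement on functions reduces to this through effective domains; conversely,
   an M-convex f is f plus the indicator function of its effective domain. *)

theory Submission imports Defs
begin

definition coord_sum :: "int ^ 'n \<Rightarrow> int" where
  "coord_sum x = (\<Sum>k\<in>UNIV. x $ k)"

lemma coord_sum_add: "coord_sum (x + y) = coord_sum x + coord_sum y"
  by (simp add: coord_sum_def sum.distrib)

lemma coord_sum_diff: "coord_sum (x - y) = coord_sum x - coord_sum y"
  by (simp add: coord_sum_def sum_subtractf)

lemma coord_sum_axis: "coord_sum (axis i c) = c"
  by (simp add: coord_sum_def axis_def)

lemmas coord_sum_simps = coord_sum_add coord_sum_diff coord_sum_axis

lemma supp_neg_minus_swap: "supp_neg (y - x) = supp_pos (x - y)"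
  by (simp add: supp_neg_def supp_pos_def)

text \<open>With \<open>y\<close> fixed, the induction runs on the total excess of \<open>x\<close>
  over \<open>y\<close>, which drops whenever \<open>x\<close> is exchanged at an index of
  \<open>supp_pos (x - y)\<close>.\<close>

lemma M_convex_set_coord_sum:
  assumes S: "M_convex_set S" and "x \<in> S" "y \<in> S"
  shows "coord_sum x = coord_sum y"
  using \<open>x \<in> S\<close>
proof (induction "\<Sum>k\<in>UNIV. nat (x $ k - y $ k)" arbitrary: x rule: less_induct)
  case less
  show ?case
  proof (cases "supp_pos (x - y) = {}")
    case True
    \<comment> \<open>An exchange from \<open>y\<close> towards \<open>x\<close> would need a
      partner in \<open>supp_neg (y - x)\<close>, which is the empty set
      \<open>supp_pos (x - y)\<close>.\<close>
    then have "supp_pos (y - x) = {}"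
      using S \<open>y \<in> S\<close> less.prems unfolding M_convex_set_def
      by (metis all_not_in_conv supp_neg_minus_swap)
    with True have "x = y"
      by (simp add: supp_pos_def vec_eq_iff order_antisym linorder_not_less)
    then show ?thesis by simp
  next
    case False
    then obtain i where i: "i \<in> supp_pos (x - y)" by blast
    with S \<open>y \<in> S\<close> less.prems obtain j
      where j: "j \<in> supp_neg (x - y)" and x': "x - axis i 1 + axis j 1 \<in> S"
      unfolding M_convex_set_def by blast
    let ?x = "x - axis i 1 + axis j 1"
    \<comment> \<open>The summand at \<open>i\<close> drops by one. The one at \<open>j\<close>
      stays 0, because over the integers \<open>x $ j < y $ j\<close> leaves room for adding
      one.\<close>
    have "(\<Sum>k\<in>UNIV. nat (?x $ k - y $ k)) < (\<Sum>k\<in>UNIV. nat (x $ k - y $ k))"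
    proof (rule sum_strict_mono_ex1)
      show "\<forall>k\<in>UNIV. nat (?x $ k - y $ k) \<le> nat (x $ k - y $ k)"
        using i j by (auto simp: axis_def supp_pos_def supp_neg_def)
      show "\<exists>k\<in>UNIV. nat (?x $ k - y $ k) < nat (x $ k - y $ k)"
        using i j by (intro bexI[of _ i]) (auto simp: axis_def supp_pos_def supp_neg_def)
    qed simp
    then have "coord_sum ?x = coord_sum y"
      using less.hyps x' by blast
    then show ?thesis by (simp add: coord_sum_simps)
  qed
qed

lemma M_convex_set_imp_Mnat: "M_convex_set S \<Longrightarrow> Mnat_convex_set S"
  unfolding M_convex_set_def Mnat_convex_set_def by blast

lemma M_convex_set_iff: "M_convex_set S \<longleftrightarrow> M2_convex_set S \<and> Mnat_convex_set S"
proof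
  assume "M_convex_set S"
  \<comment> \<open>M2-convexity comes from writing \<open>S\<close> as
    \<open>S \<inter> S\<close>.\<close>
  then show "M2_convex_set S \<and> Mnat_convex_set S"
    using M_convex_set_imp_Mnat by (auto simp: M2_convex_set_def M_convex_set_def)
next
  assume *: "M2_convex_set S \<and> Mnat_convex_set S"
  then obtain S1 where S1: "M_convex_set S1" "S \<subseteq> S1"
    unfolding M2_convex_set_def by blast
  have "\<not> x - axis i 1 \<in> S" if "x \<in> S" for x i
  proof
    assume "x - axis i 1 \<in> S"
    then have "coord_sum (x - axis i 1) = coord_sum x"
      using M_convex_set_coord_sum S1 that by blast
    then show False by (simp add: coord_sum_simps)
  qed
  with * show "M_convex_set S"
    unfolding Mnat_convex_set_def M_convex_set_def by blast
qed

definition indicator_fun :: "(int ^ 'n) set \<Rightarrow> int ^ 'n \<Rightarrow> ereal" where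
  "indicator_fun S x = (if x \<in> S then 0 else \<infinity>)"

lemma eff_dom_indicator_fun: "eff_dom (indicator_fun S) = S"
  by (auto simp: eff_dom_def indicator_fun_def)

text \<open>The index \<open>j\<close> of a set exchange makes the entry at \<open>Some j\<close>
  equal to 0, which bounds the minimum.\<close>

lemma M_convex_fun_indicator_fun:
  assumes S: "M_convex_set S"
  shows "M_convex_fun (indicator_fun S)"
proof -
  have "Min ((\<lambda>j. indicator_fun S (x - axis i 1 + unit_vec0 j)
               + indicator_fun S (y + axis i 1 - unit_vec0 j))
               ` (Some ` supp_neg (x - y) \<union> {None}))
         \<le> indicator_fun S x + indicator_fun S y"
    if xy: "x \<in> S" "y \<in> S" and i: "i \<in> supp_pos (x - y)" for x y i
  proof -
    obtain j where "j \<in> supp_neg (x - y)"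
      "x - axis i 1 + axis j 1 \<in> S" "y + axis i 1 - axis j 1 \<in> S"
      using S xy i unfolding M_convex_set_def by blast
    then show ?thesis
      using xy
      by (intro Min_le_iff[THEN iffD2] bexI[OF _ imageI[of "Some j"]])
         (auto simp: indicator_fun_def)
  qed
  moreover have "proper_fun (indicator_fun S)"
    using S by (auto simp: proper_fun_def eff_dom_indicator_fun M_convex_set_def indicator_fun_def)
  ultimately show ?thesis
    using S by (simp add: M_convex_fun_def Mnat_convex_fun_def eff_dom_indicator_fun)
qed

text \<open>A finite upper bound on the minimum forces some entry below \<infinity>, and both of its
  summands are then below \<infinity>. The index \<open>None\<close> yields the first alternative of
  the set axiom, \<open>Some j\<close> the second.\<close>

lemma Mnat_convex_set_eff_dom:
  assumes f: "Mnat_convex_fun f"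
  shows "Mnat_convex_set (eff_dom f)"
proof -
  have "(x - axis i 1 \<in> eff_dom f \<and> y + axis i 1 \<in> eff_dom f) \<or>
       (\<exists>j\<in>supp_neg (x - y). x - axis i 1 + axis j 1 \<in> eff_dom f
          \<and> y + axis i 1 - axis j 1 \<in> eff_dom f)"
    if xy: "x \<in> eff_dom f" "y \<in> eff_dom f" and i: "i \<in> supp_pos (x - y)" for x y i
  proof -
    let ?J = "Some ` supp_neg (x - y) \<union> {None}"
    let ?g = "\<lambda>j. f (x - axis i 1 + unit_vec0 j) + f (y + axis i 1 - unit_vec0 j)"
    have "Min (?g ` ?J) \<le> f x + f y"
      using f xy i unfolding Mnat_convex_fun_def by blast
    also have "\<dots> < \<infinity>"
      using xy by (simp add: eff_dom_def)
    finally have "\<exists>a\<in>?g ` ?J. a < \<infinity>"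
      by (subst (asm) Min_less_iff) simp_all
    then obtain j where j: "j \<in> ?J" "?g j < \<infinity>" by blast
    then have "x - axis i 1 + unit_vec0 j \<in> eff_dom f" "y + axis i 1 - unit_vec0 j \<in> eff_dom f"
      by (auto simp: eff_dom_def)
    with j(1) show ?thesis by auto
  qed
  then show ?thesis
    using f by (auto simp: Mnat_convex_set_def Mnat_convex_fun_def proper_fun_def)
qed

lemma M2_convex_set_eff_dom:
  assumes "M2_convex_fun f"
  shows "M2_convex_set (eff_dom f)"
proof -
  obtain f1 f2 where f12: "M_convex_fun f1" "M_convex_fun f2" "f = (\<lambda>x. f1 x + f2 x)"
    using assms unfolding M2_convex_fun_def by blast
  \<comment> \<open>In \<open>ereal\<close> a sum is \<infinity> exactly when one of its summands
    is.\<close>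
  then have "eff_dom f = eff_dom f1 \<inter> eff_dom f2"
    by (auto simp: eff_dom_def)
  with f12 assms show ?thesis
    unfolding M2_convex_set_def M2_convex_fun_def M_convex_fun_def by blast
qed

lemma M_convex_fun_imp_M2:
  assumes f: "M_convex_fun f"
  shows "M2_convex_fun f"
proof -
  have "f = (\<lambda>x. f x + indicator_fun (eff_dom f) x)"
    using f by (auto simp: indicator_fun_def eff_dom_def M_convex_fun_def Mnat_convex_fun_def
        proper_fun_def)
  then show ?thesis
    using f M_convex_fun_indicator_fun[of "eff_dom f"]
    unfolding M2_convex_fun_def M_convex_fun_def M_convex_set_def by blast
qed

lemma M_convex_fun_iff: "M_convex_fun f \<longleftrightarrow> M2_convex_fun f \<and> Mnat_convex_fun f"
proof
  assume "M_convex_fun f"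
  then show "M2_convex_fun f \<and> Mnat_convex_fun f"
    using M_convex_fun_imp_M2 by (simp add: M_convex_fun_def)
next
  assume "M2_convex_fun f \<and> Mnat_convex_fun f"
  \<comment> \<open>Only M-convexity of \<open>eff_dom f\<close> is left to show, and the
    equivalence for sets supplies it.\<close>
  then show "M_convex_fun f"
    using M2_convex_set_eff_dom Mnat_convex_set_eff_dom M_convex_set_iff
    by (auto simp: M_convex_fun_def)
qed

theorem theorem4p2:
  "(\<forall>S :: (int ^ 'n) set.
      M_convex_set S \<longleftrightarrow> M2_convex_set S \<and> Mnat_convex_set S) \<and>
   (\<forall>f :: int ^ 'n \<Rightarrow> ereal. proper_fun f \<longrightarrow>
      (M_convex_fun f \<longleftrightarrow> M2_convex_fun f \<and> Mnat_convex_fun f))"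
  using M_convex_set_iff M_convex_fun_iff by blast

end
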